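(* Let $\varphi:P\to Q$ be an order-preserving map between finite posets and let $X:Q\to\mathcal{P}_{<\infty}$ be a diagram of finite posets. If $\varphi^{-1}(F_q)$ is homotopically trivial for every $q\in Q$, where $F_q=\{r\in Q: r\ge q\}$, then the canonical map $\operatorname{\underline{hocolim}}\varphi^*X\to\operatorname{\underline{hocolim}} X$ is a weak equivalence.
   Context: Posets are viewed as categories with a unique arrow $p\to q$ iff $p\le q$; $\mathcal{P}_{<\infty}$ is the category of finite posets and order-preserving maps. Write $X_q=X(q)$, $f_{qq'}=X(q\to q')$. $\operatorname{\underline{hocolim}} X$ is the poset on $\coprod_{q}X_q$ keeping the order within each $X_q$ and, for $x\in X_q$, $y\in X_{q'}$, $q\le q'$, setting $x\le y$ iff $f_{qq'}(x)\le y$ in $X_{q'}$. $\varphi^*X=X\circ\varphi$ is the pulled-back $P$-diagram, and the canonical map $\operatorname{\underline{hocolim}}\varphi^*X\to\operatorname{\underline{hocolim}} X$ is induced by the identities $(\varphi^*X)_p=X_{\varphi(p)}$. A finite poset is homotopically trivial if its order complex is contractible. Finite posets are finite topological spaces with the down-sets as open sets; a weak equivalence is a continuous map inducing isomorphisms on all homotopy groups (equivalently its map on order complexes is a homotopy equivalence). *)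

theory Defs
  imports "HOL-Analysis.Analysis"
begin

definition fin_poset :: "'a set \<Rightarrow> ('a \<Rightarrow> 'a \<Rightarrow> bool) \<Rightarrow> bool" where
  "fin_poset A le \<longleftrightarrow> finite A \<and>
     (\<forall>x\<in>A. le x x) \<and>
     (\<forall>x\<in>A. \<forall>y\<in>A. le x y \<and> le y x \<longrightarrow> x = y) \<and>
     (\<forall>x\<in>A. \<forall>y\<in>A. \<forall>z\<in>A. le x y \<and> le y z \<longrightarrow> le x z)"

definition order_preserving ::
  "'a set \<Rightarrow> ('a \<Rightarrow> 'a \<Rightarrow> bool) \<Rightarrow> 'b set \<Rightarrow> ('b \<Rightarrow> 'b \<Rightarrow> bool) \<Rightarrow> ('a \<Rightarrow> 'b) \<Rightarrow> bool" where
  "order_preserving A leA B leB g \<longleftrightarrow>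
     (\<forall>x\<in>A. g x \<in> B) \<and> (\<forall>x\<in>A. \<forall>y\<in>A. leA x y \<longrightarrow> leB (g x) (g y))"

definition is_chain :: "'a set \<Rightarrow> ('a \<Rightarrow> 'a \<Rightarrow> bool) \<Rightarrow> bool" where
  "is_chain C le \<longleftrightarrow> (\<forall>x\<in>C. \<forall>y\<in>C. le x y \<or> le y x)"

(* Geometric realisation of the order complex of (A, le): functions A \<rightarrow> [0,1]
   (extensional on A) summing to 1 whose support is a chain, with the topology
   induced from the product topology on A \<rightarrow> \<real>. *)
definition order_complex :: "'a set \<Rightarrow> ('a \<Rightarrow> 'a \<Rightarrow> bool) \<Rightarrow> ('a \<Rightarrow> real) topology" where
  "order_complex A le = subtopology (powertop_real A)
     {w \<in> extensional A. (\<forall>a\<in>A. 0 \<le> w a) \<and> (\<Sum>a\<in>A. w a) = 1 \<and>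
        is_chain {a\<in>A. w a \<noteq> 0} le}"

(* Simplicial (affine) map on order complexes induced by an order-preserving map g. *)
definition realize_map :: "'a set \<Rightarrow> 'b set \<Rightarrow> ('a \<Rightarrow> 'b) \<Rightarrow> ('a \<Rightarrow> real) \<Rightarrow> ('b \<Rightarrow> real)" where
  "realize_map A B g w = (\<lambda>b\<in>B. \<Sum>a\<in>{a\<in>A. g a = b}. w a)"

definition homotopy_equivalence_map ::
  "'a topology \<Rightarrow> 'b topology \<Rightarrow> ('a \<Rightarrow> 'b) \<Rightarrow> bool" where
  "homotopy_equivalence_map S T f \<longleftrightarrow> continuous_map S T f \<and>
     (\<exists>g. continuous_map T S g \<and>
          homotopic_with (\<lambda>x. True) S S (g \<circ> f) id \<and>
          homotopic_with (\<lambda>x. True) T T (f \<circ> g) id)"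

definition homotopically_trivial :: "'a set \<Rightarrow> ('a \<Rightarrow> 'a \<Rightarrow> bool) \<Rightarrow> bool" where
  "homotopically_trivial A le \<longleftrightarrow>
     topspace (order_complex A le) \<noteq> {} \<and> contractible_space (order_complex A le)"

(* Weak equivalence of finite posets (as finite spaces): the induced map of
   order complexes is a homotopy equivalence. *)
definition weak_equivalence ::
  "'a set \<Rightarrow> ('a \<Rightarrow> 'a \<Rightarrow> bool) \<Rightarrow> 'b set \<Rightarrow> ('b \<Rightarrow> 'b \<Rightarrow> bool) \<Rightarrow> ('a \<Rightarrow> 'b) \<Rightarrow> bool" where
  "weak_equivalence A leA B leB g \<longleftrightarrow>
     order_preserving A leA B leB g \<and>
     homotopy_equivalence_map (order_complex A leA) (order_complex B leB) (realize_map A B g)"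

definition poset_diagram ::
  "'q set \<Rightarrow> ('q \<Rightarrow> 'q \<Rightarrow> bool) \<Rightarrow> ('q \<Rightarrow> 'x set) \<Rightarrow> ('q \<Rightarrow> 'x \<Rightarrow> 'x \<Rightarrow> bool)
    \<Rightarrow> ('q \<Rightarrow> 'q \<Rightarrow> 'x \<Rightarrow> 'x) \<Rightarrow> bool" where
  "poset_diagram Q leQ X leX f \<longleftrightarrow>
     (\<forall>q\<in>Q. fin_poset (X q) (leX q)) \<and>
     (\<forall>q\<in>Q. \<forall>q'\<in>Q. leQ q q' \<longrightarrow> order_preserving (X q) (leX q) (X q') (leX q') (f q q')) \<and>
     (\<forall>q\<in>Q. \<forall>x\<in>X q. f q q x = x) \<and>
     (\<forall>q\<in>Q. \<forall>q'\<in>Q. \<forall>q''\<in>Q. leQ q q' \<and> leQ q' q'' \<longrightarrow>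
         (\<forall>x\<in>X q. f q' q'' (f q q' x) = f q q'' x))"

(* Underlying set and order of hocolim X (Grothendieck construction). *)
definition hocolim_set :: "'q set \<Rightarrow> ('q \<Rightarrow> 'x set) \<Rightarrow> ('q \<times> 'x) set" where
  "hocolim_set Q X = Sigma Q X"

definition hocolim_le ::
  "('q \<Rightarrow> 'q \<Rightarrow> bool) \<Rightarrow> ('q \<Rightarrow> 'x \<Rightarrow> 'x \<Rightarrow> bool) \<Rightarrow> ('q \<Rightarrow> 'q \<Rightarrow> 'x \<Rightarrow> 'x)
    \<Rightarrow> ('q \<times> 'x) \<Rightarrow> ('q \<times> 'x) \<Rightarrow> bool" where
  "hocolim_le leQ leX f a b \<longleftrightarrow> leQ (fst a) (fst b) \<and> leX (fst b) (f (fst a) (fst b) (snd a)) (snd b)"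

definition up_set :: "'q set \<Rightarrow> ('q \<Rightarrow> 'q \<Rightarrow> bool) \<Rightarrow> 'q \<Rightarrow> 'q set" where
  "up_set Q leQ q = {r\<in>Q. leQ q r}"

end

theory Submission
  imports Defs
begin

text \<open>
  Over \<open>(q, x)\<close> the canonical map has upper fibre
  \<open>{(p, y). q \<le> \<phi> p \<and> f q (\<phi> p) x \<le> y}\<close>. Lowering \<open>(p, y)\<close> to \<open>(p, f q (\<phi> p) x)\<close> retracts it onto a
  copy of the preimage of the up-set of \<open>q\<close> under \<open>\<phi>\<close>, and comparable monotone maps are homotopic, so
  all upper fibres are contractible and Quillen's fibre lemma applies.

  Both the fibre lemma and the homotopy of comparable maps come from contractible carriers. Let \<open>C\<close>
  assign to each element of a finite poset \<open>B\<close> a contractible subspace of \<open>Y\<close>, antitonically.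
  Then there is a map from the order complex of \<open>B\<close> to \<open>Y\<close> sending the complex of each up-set
  of \<open>b\<close> into \<open>C b\<close>, and it is unique up to homotopy. Such maps are extended over one minimal
  element \<open>b\<close> at a time: adding \<open>b\<close> attaches a cone over the complex of the elements above \<open>b\<close>, and
  the map on the base of the cone already lands in the contractible space \<open>C b\<close>.
\<close>

section \<open>Gluing, and extension into contractible spaces\<close>

lemma continuous_map_closed_pasting:
  assumes "closedin X S" "closedin X T" "topspace X \<subseteq> S \<union> T"
    and "continuous_map (subtopology X S) Y f" "continuous_map (subtopology X T) Y g"
    and "\<And>x. x \<in> S \<Longrightarrow> x \<in> T \<Longrightarrow> f x = g x"
  shows "continuous_map X Y (\<lambda>x. if x \<in> S then f x else g x)"
proof (rule pasting_lemma_closed[where I = "UNIV :: bool set" and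
      T = "\<lambda>i. if i then S else T" and f = "\<lambda>i. if i then f else g"])
  show "\<exists>j. j \<in> UNIV \<and> x \<in> (if j then S else T) \<and>
      (if x \<in> S then f x else g x) = (if j then f else g) x" if "x \<in> topspace X" for x
    using that assms(3) by (intro exI[of _ "x \<in> S"]) auto
qed (use assms in \<open>auto split: if_splits\<close>)

text \<open>\<open>\<rho>\<close> acts as a radial coordinate with rim \<open>\<rho> = 1\<close>.
  The collar \<open>1/2 \<le> \<rho>\<close> retracts onto the rim by \<open>r\<close>, so
  \<open>h \<circ> r\<close> is defined there; a contraction of \<open>Y\<close> deforms it to a
  constant as \<open>\<rho>\<close> drops to \<open>1/2\<close>, and this constant fills the core.
  In the application \<open>r\<close> is a radial projection, which breaks down at the centre, so
  continuity of \<open>r\<close> is asked for on the collar only.\<close>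

lemma contractible_extension:
  fixes Z :: "'z topology" and \<rho> :: "'z \<Rightarrow> real"
  assumes \<rho>: "continuous_map Z euclideanreal \<rho>" and le1: "\<And>z. z \<in> topspace Z \<Longrightarrow> \<rho> z \<le> 1"
    and r: "continuous_map (subtopology Z {z. 1/2 \<le> \<rho> z}) (subtopology Z {z. \<rho> z = 1}) r"
    and rid: "\<And>z. z \<in> topspace Z \<Longrightarrow> \<rho> z = 1 \<Longrightarrow> r z = z"
    and h: "continuous_map (subtopology Z {z. \<rho> z = 1}) Y h"
    and Y: "contractible_space Y" "topspace Y \<noteq> {}"
  obtains H where "continuous_map Z Y H" "\<And>z. z \<in> topspace Z \<Longrightarrow> \<rho> z = 1 \<Longrightarrow> H z = h z"
proof -
  obtain a where "homotopic_with (\<lambda>x. True) Y Y id (\<lambda>x. a)"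
    using Y by (auto simp: contractible_space_def)
  \<comment> \<open>\<open>contractible_space\<close> also holds for the empty space; nonemptiness
    of \<open>Y\<close> is what places \<open>a\<close> in \<open>Y\<close>.\<close>
  moreover from homotopic_with_imp_continuous_maps[OF this] have a: "a \<in> topspace Y"
    using Y(2) by (auto simp: continuous_map_def Pi_iff)
  ultimately obtain c where c: "continuous_map (prod_topology (top_of_set {0..1::real}) Y) Y c"
    and c0: "\<And>x. c (0, x) = x" and c1: "\<And>x. c (1, x) = a"
    by (auto simp: homotopic_with_def)
  \<comment> \<open>The time \<open>2 - 2 * \<rho> z\<close> is 0 on the rim, giving
    \<open>h\<close>, and 1 at \<open>\<rho> z = 1/2\<close>, where both branches equal
    \<open>a\<close>.\<close>
  define H where "H = (\<lambda>z. if \<rho> z \<le> 1/2 then a else c (2 - 2 * \<rho> z, h (r z)))"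
  let ?Z = "subtopology Z {z. z \<in> topspace Z \<and> 1/2 \<le> \<rho> z}"
  have r': "continuous_map ?Z (subtopology Z {z. \<rho> z = 1}) r"
    by (rule continuous_map_from_subtopology_mono[OF r]) auto
  have hr: "continuous_map ?Z Y (\<lambda>z. h (r z))"
    using continuous_map_compose[OF r' h] by (simp add: o_def)
  have \<rho>': "continuous_map ?Z (top_of_set {0..1}) (\<lambda>z. 2 - 2 * \<rho> z)"
    using le1 by (intro continuous_map_into_subtopology continuous_intros
        continuous_map_from_subtopology[OF \<rho>]) auto
  have half: "c (2 - 2 * \<rho> z, h (r z)) = a" if "\<rho> z = 1/2" for z
  proof -
    have "2 - 2 * \<rho> z = 1" using that by simp
    then show ?thesis using c1 by simp
  qed
  have "continuous_map ?Z Y (c \<circ> (\<lambda>z. (2 - 2 * \<rho> z, h (r z))))"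
    by (rule continuous_map_compose[OF continuous_map_pairedI[OF \<rho>' hr] c])
  then have "continuous_map Z Y H"
    unfolding H_def
    by (intro continuous_map_cases_le) (use \<rho> a half in \<open>auto simp: o_def\<close>)
  moreover have "H z = h z" if "z \<in> topspace Z" "\<rho> z = 1" for z
    using that by (simp add: H_def c0 rid)
  ultimately show ?thesis using that by blast
qed

section \<open>Finite posets and their order complexes\<close>

text \<open>An element of \<open>U\<close> with the fewest elements of \<open>B\<close> below it is
  minimal: by antisymmetry and transitivity, a strictly smaller one would have strictly
  fewer.\<close>

lemma fin_poset_minimal:
  assumes "fin_poset B le" "U \<subseteq> B" "U \<noteq> {}"
  obtains b where "b \<in> U" "\<And>a. a \<in> U \<Longrightarrow> le a b \<Longrightarrow> a = b"
proof -
  obtain b where b: "b \<in> U" and min: "\<And>a. a \<in> U \<Longrightarrow> card {x\<in>B. le x b} \<le> card {x\<in>B. le x a}"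
    using assms(3) ex_has_least_nat[of "\<lambda>b. b \<in> U" _ "\<lambda>b. card {x\<in>B. le x b}"] by blast
  have "a = b" if "a \<in> U" "le a b" for a
  proof (rule ccontr)
    assume "a \<noteq> b"
    have "{x\<in>B. le x a} \<subset> {x\<in>B. le x b}"
    proof -
      have "{x\<in>B. le x a} \<subseteq> {x\<in>B. le x b}"
        using that b assms unfolding fin_poset_def by blast
      moreover have "b \<in> {x\<in>B. le x b}" "b \<notin> {x\<in>B. le x a}"
        using that b assms \<open>a \<noteq> b\<close> unfolding fin_poset_def by blast+
      ultimately show ?thesis by blast
    qed
    then have "card {x\<in>B. le x a} < card {x\<in>B. le x b}"
      using assms(1) by (intro psubset_card_mono) (auto simp: fin_poset_def)
    with min[OF that(1)] show False by simp
  qed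
  with b that show ?thesis by blast
qed

lemma topspace_order_complex:
  "topspace (order_complex A le) = {w \<in> extensional A. (\<forall>a\<in>A. 0 \<le> w a) \<and> (\<Sum>a\<in>A. w a) = 1 \<and>
        is_chain {a\<in>A. w a \<noteq> 0} le}"
  by (auto simp: order_complex_def PiE_def)

text \<open>The topology is induced from a product, so continuity is tested coordinatewise once the
  values are known to lie in the complex. Maps given by explicit formulas are verified in this way
  below.\<close>

lemma continuous_map_into_order_complex:
  "continuous_map Z (order_complex A le) F \<longleftrightarrow>
     F \<in> topspace Z \<rightarrow> topspace (order_complex A le) \<and>
     (\<forall>a\<in>A. continuous_map Z euclideanreal (\<lambda>z. F z a))"
  unfolding topspace_order_complex
  by (auto simp: order_complex_def continuous_map_in_subtopology continuous_map_componentwise)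

lemma continuous_map_order_complex_eval:
  "a \<in> A \<Longrightarrow> continuous_map (order_complex A le) euclideanreal (\<lambda>w. w a)"
  using continuous_map_into_order_complex[of "order_complex A le" A le id] by auto

text \<open>Restricting to a subset is modelled inside the ambient complex, since points of
  \<^term>\<open>order_complex U le\<close> are extensional on \<^term>\<open>U\<close> and hence not points of
  \<^term>\<open>order_complex A le\<close>.\<close>

definition full_subcomplex :: "'a set \<Rightarrow> ('a \<Rightarrow> 'a \<Rightarrow> bool) \<Rightarrow> 'a set \<Rightarrow> ('a \<Rightarrow> real) set" where
  "full_subcomplex A le U = {w \<in> topspace (order_complex A le). \<forall>a\<in>A. a \<notin> U \<longrightarrow> w a = 0}"

lemma full_subcomplex_subset_topspace: "full_subcomplex A le U \<subseteq> topspace (order_complex A le)"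
  by (auto simp: full_subcomplex_def)

lemma full_subcomplex_mono:
  "U \<inter> A \<subseteq> V \<Longrightarrow> full_subcomplex A le U \<subseteq> full_subcomplex A le V"
  by (auto simp: full_subcomplex_def)

lemma full_subcomplex_self [simp]: "full_subcomplex A le A = topspace (order_complex A le)"
  by (auto simp: full_subcomplex_def)

lemma full_subcomplex_empty [simp]: "full_subcomplex A le {} = {}"
  by (auto simp: full_subcomplex_def topspace_order_complex)

lemma closedin_full_subcomplex: "closedin (order_complex A le) (full_subcomplex A le U)"
proof -
  have "full_subcomplex A le U = topspace (order_complex A le) \<inter>
      (\<Inter>a\<in>A - U. {w \<in> topspace (order_complex A le). w a \<in> {0}})"
    by (auto simp: full_subcomplex_def)
  moreover have "closedin (order_complex A le) (topspace (order_complex A le) \<inter>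
      (\<Inter>a\<in>A - U. {w \<in> topspace (order_complex A le). w a \<in> {0}}))"
  \<comment> \<open>An empty family has intersection \<open>UNIV\<close>, so the case
    \<open>A \<subseteq> U\<close> is treated apart.\<close>
  proof (cases "A - U = {}")
    case False
    show ?thesis
      by (intro closedin_Int closedin_topspace closedin_INT False
          closedin_continuous_map_preimage[OF continuous_map_order_complex_eval]) auto
  qed (simp only: INT_empty image_empty Inter_empty Int_UNIV_right closedin_topspace)
  ultimately show ?thesis by simp
qed

text \<open>A support is a nonempty chain, and a minimal element of a chain is its least. So every
  point lies in the subcomplex of the up-set of some \<open>b\<close>, with \<open>b\<close> itself
  in the support.\<close>

lemma order_complex_support_least:
  assumes "fin_poset B le" "w \<in> topspace (order_complex B le)"
  obtains b where "b \<in> B" "w b \<noteq> 0" "w \<in> full_subcomplex B le (up_set B le b)"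
proof -
  let ?S = "{a\<in>B. w a \<noteq> 0}"
  have "?S \<noteq> {}"
    using assms(2) by (auto simp: topspace_order_complex intro!: sum.neutral)
       (metis (mono_tags, lifting) sum.neutral zero_neq_one)
  then obtain b where b: "b \<in> ?S" "\<And>a. a \<in> ?S \<Longrightarrow> le a b \<Longrightarrow> a = b"
    using fin_poset_minimal[OF assms(1), of ?S] by blast
  have "le b a" if "a \<in> ?S" for a
  proof -
    have "le a b \<or> le b a"
      using assms(2) that b(1) unfolding topspace_order_complex is_chain_def by blast
    then show ?thesis using b that assms(1) by (auto simp: fin_poset_def)
  qed
  then show ?thesis
    using b that assms(2) by (auto simp: full_subcomplex_def up_set_def)
qed

lemma order_complex_le_1:
  assumes "finite A" "w \<in> topspace (order_complex A le)" "a \<in> A"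
  shows "0 \<le> w a" "w a \<le> 1"
proof -
  show "0 \<le> w a" using assms by (auto simp: topspace_order_complex)
  have "w a \<le> (\<Sum>a\<in>A. w a)"
    using assms by (intro member_le_sum) (auto simp: topspace_order_complex)
  then show "w a \<le> 1" using assms by (auto simp: topspace_order_complex)
qed

section \<open>Maps and homotopies governed by contractible carriers\<close>

text \<open>The subcomplex on \<open>up_set B le b\<close> is a cone with apex \<open>b\<close>, and
  \<open>1 - w b\<close> measures the distance from the apex. Dividing that distance by
  \<open>\<rho>\<close> moves the point along its ray; the bound \<open>1 - w b \<le> \<rho>\<close>
  keeps the weight at \<open>b\<close> nonnegative. The support can gain at most \<open>b\<close>,
  which is comparable with everything above it.\<close>

lemma order_complex_star_rescale:
  fixes \<rho> :: real
  assumes "fin_poset B le" "b \<in> B" and w: "w \<in> full_subcomplex B le (up_set B le b)"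
    and \<rho>: "0 < \<rho>" "1 - w b \<le> \<rho>"
  shows "(\<lambda>a\<in>B. if a = b then 1 - (1 - w b) / \<rho> else w a / \<rho>) \<in> full_subcomplex B le (up_set B le b)"
    (is "?v \<in> _")
proof -
  have fin: "finite B" using assms by (simp add: fin_poset_def)
  have w': "w \<in> topspace (order_complex B le)" using w by (simp add: full_subcomplex_def)
  have "(\<Sum>a\<in>B. ?v a) = ?v b + (\<Sum>a\<in>B - {b}. ?v a)"
    using fin assms(2) by (simp add: sum.remove)
  also have "(\<Sum>a\<in>B - {b}. ?v a) = (\<Sum>a\<in>B - {b}. w a) / \<rho>"
    unfolding sum_divide_distrib by (intro sum.cong) auto
  also have "(\<Sum>a\<in>B - {b}. w a) = 1 - w b"
    using w' sum.remove[OF fin assms(2), of w] by (simp add: topspace_order_complex)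
  finally have sum: "(\<Sum>a\<in>B. ?v a) = 1" using assms(2) by simp
  have up: "a \<in> up_set B le b" if "a \<in> B" "?v a \<noteq> 0" for a
  proof (cases "a = b")
    case True
    then show ?thesis using assms(1,2) by (simp add: up_set_def fin_poset_def)
  next
    case False
    then have "w a \<noteq> 0" using that by simp
    then show ?thesis using that(1) w by (auto simp: full_subcomplex_def)
  qed
  have "is_chain {a\<in>B. ?v a \<noteq> 0} le"
    unfolding is_chain_def
  proof (intro ballI)
    fix x y assume xy: "x \<in> {a\<in>B. ?v a \<noteq> 0}" "y \<in> {a\<in>B. ?v a \<noteq> 0}"
    show "le x y \<or> le y x"
    proof (cases "x = b \<or> y = b")
      case True
      then show ?thesis using up xy by (auto simp: up_set_def)
    next
      case False
      then have "x \<in> {a\<in>B. w a \<noteq> 0}" "y \<in> {a\<in>B. w a \<noteq> 0}" using xy by auto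
      then show ?thesis using w' unfolding topspace_order_complex is_chain_def by blast
    qed
  qed
  moreover have "0 \<le> ?v a" if "a \<in> B" for a
    using \<rho> that order_complex_le_1[OF fin w' that] by auto
  ultimately show ?thesis
    using sum up unfolding full_subcomplex_def topspace_order_complex by blast
qed

text \<open>The parameter interval is \<open>{0}\<close> or \<open>[-1, 1]\<close>: the first case produces carried maps, the
  second one, with both ends prescribed by \<open>h\<close>, homotopies between them.\<close>

lemma carrier_extension:
  fixes B :: "'b set" and le :: "'b \<Rightarrow> 'b \<Rightarrow> bool" and Y :: "'y topology" and c :: real
  defines "K \<equiv> order_complex B le"
  defines "Z \<equiv> prod_topology (top_of_set {-c..c}) K"
  assumes c: "c = 0 \<or> c = 1" and B: "fin_poset B le"
    and sub: "\<And>b. b \<in> B \<Longrightarrow> C b \<subseteq> topspace Y"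
    and ne: "\<And>b. b \<in> B \<Longrightarrow> C b \<noteq> {}"
    and contr: "\<And>b. b \<in> B \<Longrightarrow> contractible_space (subtopology Y (C b))"
    and anti: "\<And>a b. a \<in> B \<Longrightarrow> b \<in> B \<Longrightarrow> le a b \<Longrightarrow> C b \<subseteq> C a"
    and h: "continuous_map (subtopology Z {z. \<bar>fst z\<bar> = 1}) Y h"
    and hC: "\<And>t w b. t \<in> {-c..c} \<Longrightarrow> \<bar>t\<bar> = 1 \<Longrightarrow> b \<in> B \<Longrightarrow> w \<in> full_subcomplex B le (up_set B le b) \<Longrightarrow> h (t, w) \<in> C b"
  obtains H where "continuous_map Z Y H"
    "\<And>t w. t \<in> {-c..c} \<Longrightarrow> w \<in> topspace K \<Longrightarrow> \<bar>t\<bar> = 1 \<Longrightarrow> H (t, w) = h (t, w)"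
    "\<And>t w b. t \<in> {-c..c} \<Longrightarrow> b \<in> B \<Longrightarrow> w \<in> full_subcomplex B le (up_set B le b) \<Longrightarrow> H (t, w) \<in> C b"
proof -
  define G where "G = (\<lambda>U. {-c..c} \<times> full_subcomplex B le U)"
  have fin: "finite B" and refl: "\<And>a. a \<in> B \<Longrightarrow> le a a"
    using B by (auto simp: fin_poset_def)
  have topZ: "topspace Z = {-c..c} \<times> topspace K" by (simp add: Z_def)
  have closedG: "closedin Z (G U)" for U
    unfolding G_def Z_def K_def closedin_prod_Times_iff using closedin_full_subcomplex by auto
  have Gsub: "G U \<subseteq> topspace Z" for U
    using closedG closedin_subset by blast
  have contfst: "continuous_map Z euclideanreal fst"
    unfolding Z_def using continuous_map_fst continuous_map_into_fulltopology by blast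
  have contsnd: "continuous_map Z euclideanreal (\<lambda>z. snd z a)" if "a \<in> B" for a
    using continuous_map_compose[OF continuous_map_snd continuous_map_order_complex_eval[OF that]]
    unfolding Z_def K_def o_def by blast
  \<comment> \<open>Induction over upward closed \<open>U\<close>, up to \<open>U = B\<close>: a
    minimal element \<open>b\<close> of \<open>U\<close> is removed, and \<open>V = U - {b}\<close>
    is again upward closed. The map is built on the cylinder \<open>G U\<close> over the subcomplex
    on \<open>U\<close>.\<close>
  have "\<exists>H. continuous_map (subtopology Z (G U)) Y H \<and>
      (\<forall>(t, w) \<in> G U. \<bar>t\<bar> = 1 \<longrightarrow> H (t, w) = h (t, w)) \<and>
      (\<forall>b\<in>U. \<forall>(t, w) \<in> G (up_set B le b). H (t, w) \<in> C b)"
    if "U \<subseteq> B" "\<forall>a\<in>U. \<forall>b\<in>B. le a b \<longrightarrow> b \<in> U" for U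
    using finite_subset[OF that(1) fin] that
  proof (induction U rule: finite_psubset_induct)
    case (psubset U)
    show ?case
    proof (cases "U = {}")
      case True
      then show ?thesis by (auto simp: G_def continuous_map_on_empty)
    next
      case False
      obtain b where b: "b \<in> U" and bmin: "\<And>a. a \<in> U \<Longrightarrow> le a b \<Longrightarrow> a = b"
        using fin_poset_minimal[OF B psubset.prems(1) False] by metis
      have bB: "b \<in> B" using b psubset.prems by blast
      define V where "V = U - {b}"
      have V: "V \<subset> U" "V \<subseteq> B" "\<forall>a\<in>V. \<forall>x\<in>B. le a x \<longrightarrow> x \<in> V"
        using b bmin psubset.prems unfolding V_def by blast+
      obtain H' where H'cont: "continuous_map (subtopology Z (G V)) Y H'"
        and H'h: "\<And>t w. (t, w) \<in> G V \<Longrightarrow> \<bar>t\<bar> = 1 \<Longrightarrow> H' (t, w) = h (t, w)"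
        and H'C: "\<And>a t w. a \<in> V \<Longrightarrow> (t, w) \<in> G (up_set B le a) \<Longrightarrow> H' (t, w) \<in> C a"
        using psubset.IH[OF V] by blast
      define St where "St = G (up_set B le b)"
      \<comment> \<open>Radial coordinate on the cylinder over the star of \<open>b\<close>: it
        vanishes at parameter 0 and vertex \<open>b\<close>, and equals 1 exactly on the ends
        \<open>\<bar>t\<bar> = 1\<close> and over the base \<open>w b = 0\<close> of the
        cone.\<close>
      define \<rho> where "\<rho> = (\<lambda>z::real \<times> ('b \<Rightarrow> real). max \<bar>fst z\<bar> (1 - snd z b))"
      define D where "D = {z. \<rho> z = 1}"
      have Stsub: "St \<subseteq> topspace Z" using Gsub by (simp add: St_def)
      have topSt: "topspace (subtopology Z St) = St" using Stsub by auto
      have w01: "0 \<le> w b" "w b \<le> 1" if "(t, w) \<in> topspace Z" for t w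
        using order_complex_le_1[OF fin _ bB] that by (auto simp: topZ K_def)
      have abs1: "\<bar>t\<bar> \<le> 1" if "(t, w) \<in> topspace Z" for t w
        using c that by (auto simp: topZ)
      have D_iff: "(t, w) \<in> D \<longleftrightarrow> \<bar>t\<bar> = 1 \<or> w b = 0" if "(t, w) \<in> topspace Z" for t w
        using w01[OF that] abs1[OF that] by (auto simp: D_def \<rho>_def max_def)
      have St_V: "z \<in> G V \<longleftrightarrow> snd z b = 0" if "z \<in> St" for z
      proof
        assume "z \<in> G V"
        then show "snd z b = 0" using bB by (auto simp: G_def full_subcomplex_def V_def)
      next
        assume *: "snd z b = 0"
        have "up_set B le b \<subseteq> U" using b psubset.prems by (auto simp: up_set_def)
        then show "z \<in> G V"
          using that * by (auto simp: St_def G_def full_subcomplex_def V_def)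
      qed
      \<comment> \<open>A chain in \<open>U\<close> containing the minimal element \<open>b\<close>
        lies entirely above \<open>b\<close>, so a point outside the star has no weight at
        \<open>b\<close>.\<close>
      have cover: "G U \<subseteq> G V \<union> St"
      proof clarify
        fix t w assume tw: "(t, w) \<in> G U" and notSt: "(t, w) \<notin> St"
        have wK: "w \<in> topspace (order_complex B le)" and supp: "\<And>a. a \<in> B \<Longrightarrow> a \<notin> U \<Longrightarrow> w a = 0"
          using tw by (auto simp: G_def full_subcomplex_def)
        have "w b = 0"
        proof (rule ccontr)
          assume "w b \<noteq> 0"
          have "a \<in> up_set B le b" if "a \<in> B" "w a \<noteq> 0" for a
          proof -
            have "le a b \<or> le b a"
              using wK that \<open>w b \<noteq> 0\<close> bB unfolding topspace_order_complex is_chain_def by blast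
            moreover have "a \<in> U" using supp that by blast
            ultimately show ?thesis using bmin that refl by (auto simp: up_set_def)
          qed
          then have "(t, w) \<in> St"
            using tw wK unfolding St_def G_def full_subcomplex_def by blast
          with notSt show False ..
        qed
        then show "(t, w) \<in> G V"
          using tw by (auto simp: G_def full_subcomplex_def V_def)
      qed
      have GU: "G V \<subseteq> G U" "St \<subseteq> G U"
      proof -
        show "G V \<subseteq> G U" using V full_subcomplex_mono[of V B U le] by (auto simp: G_def)
        have "up_set B le b \<subseteq> U" using b psubset.prems by (auto simp: up_set_def)
        then show "St \<subseteq> G U"
          using full_subcomplex_mono[of "up_set B le b" B U le] by (auto simp: St_def G_def)
      qed
      \<comment> \<open>On the rim \<open>D\<close> of the star, \<open>k\<close> is the prescribed
        value: \<open>h\<close> on the ends and the previous map \<open>H'\<close> over the base of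
        the cone.\<close>
      define k where "k = (\<lambda>z. if z \<in> {z. \<bar>fst z\<bar> = 1} then h z else H' z)"
      have k_V: "k z = H' z" if "z \<in> G V" for z
        using that H'h by (cases z) (auto simp: k_def)
      \<comment> \<open>Antitonicity of the carrier enters here: over the base, the least element
        \<open>a\<close> of the support lies strictly above \<open>b\<close>, so \<open>H'\<close>
        takes its value in \<open>C a\<close>, a subset of \<open>C b\<close>.\<close>
      have kC: "k z \<in> C b" if "z \<in> St" "z \<in> D" for z
      proof -
        obtain t w where z: "z = (t, w)" by (cases z)
        have w: "w \<in> full_subcomplex B le (up_set B le b)" and t: "t \<in> {-c..c}"
          using that z by (auto simp: St_def G_def)
        show ?thesis
        proof (cases "\<bar>t\<bar> = 1")
          case True
          then show ?thesis using hC[OF t True bB w] by (simp add: k_def z)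
        next
          case False
          then have wb: "w b = 0" using D_iff[of t w] that Stsub z by auto
          obtain a where a: "a \<in> B" "w a \<noteq> 0" "w \<in> full_subcomplex B le (up_set B le a)"
            using order_complex_support_least[OF B, of w] w by (auto simp: full_subcomplex_def)
          have "le b a" using a w by (auto simp: full_subcomplex_def up_set_def)
          moreover have "a \<noteq> b" using a wb by auto
          ultimately have "a \<in> V" using a b psubset.prems by (auto simp: V_def)
          then have "H' z \<in> C a" using H'C a t z by (auto simp: G_def)
          then show ?thesis
            using anti[OF bB a(1) \<open>le b a\<close>] False by (auto simp: k_def z)
        qed
      qed
      have kcont: "continuous_map (subtopology (subtopology Z St) D) (subtopology Y (C b)) k"
      proof (rule continuous_map_into_subtopology)
        show "k \<in> topspace (subtopology (subtopology Z St) D) \<rightarrow> C b"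
          using kC by auto
        let ?X = "subtopology (subtopology Z St) D"
        have fstX: "continuous_map ?X euclideanreal (\<lambda>z. \<bar>fst z\<bar>)"
          by (intro continuous_map_real_abs continuous_map_from_subtopology contfst)
        have cl1: "closedin ?X {z \<in> topspace ?X. \<bar>fst z\<bar> \<in> {1}}"
          by (rule closedin_continuous_map_preimage[OF fstX]) simp
        have cl2: "closedin ?X (topspace ?X \<inter> G V)"
        proof -
          have "topspace ?X \<inter> G V = G V \<inter> (St \<inter> D)" using Stsub by auto
          then show ?thesis
            unfolding subtopology_subtopology closedin_subtopology using closedG by metis
        qed
        have "continuous_map ?X Y (\<lambda>z. if z \<in> {z \<in> topspace ?X. \<bar>fst z\<bar> \<in> {1}} then h z else H' z)"
        proof (rule continuous_map_closed_pasting[OF cl1 cl2])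
          show "topspace ?X \<subseteq> {z \<in> topspace ?X. \<bar>fst z\<bar> \<in> {1}} \<union> topspace ?X \<inter> G V"
            using D_iff St_V Stsub by fastforce
          show "continuous_map (subtopology ?X {z \<in> topspace ?X. \<bar>fst z\<bar> \<in> {1}}) Y h"
            unfolding subtopology_subtopology
            by (rule continuous_map_from_subtopology_mono[OF h]) auto
          show "continuous_map (subtopology ?X (topspace ?X \<inter> G V)) Y H'"
            unfolding subtopology_subtopology
            by (rule continuous_map_from_subtopology_mono[OF H'cont]) auto
        qed (use H'h in auto)
        then show "continuous_map ?X Y k"
          by (rule continuous_map_eq) (auto simp: k_def)
      qed
      \<comment> \<open>Radial projection of the interval times the star of \<open>b\<close> from the centre \<open>(0, b)\<close>.\<close>
      define r where "r = (\<lambda>z. (fst z / \<rho> z,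
          \<lambda>a\<in>B. if a = b then 1 - (1 - snd z b) / \<rho> z else snd z a / \<rho> z))"
      have \<rho>cont: "continuous_map Z euclideanreal \<rho>"
        unfolding \<rho>_def
        by (intro continuous_map_real_max continuous_map_real_abs continuous_map_diff
            contfst contsnd bB continuous_map_canonical_const)
      have r_St: "r z \<in> St \<inter> D" if "z \<in> St" "1/2 \<le> \<rho> z" for z
      proof -
        obtain t w where z: "z = (t, w)" by (cases z)
        have w: "w \<in> full_subcomplex B le (up_set B le b)" and t: "t \<in> {-c..c}"
          using that z by (auto simp: St_def G_def)
        have "0 < \<rho> z" "1 - w b \<le> \<rho> z" "\<bar>t\<bar> \<le> \<rho> z"
          using that by (auto simp: \<rho>_def z)
        moreover from this have "t / \<rho> z \<in> {-c..c}"
          using c t by (auto simp: field_simps abs_le_iff)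
        \<comment> \<open>Both terms of the maximum defining \<open>\<rho>\<close> are divided by
          \<open>\<rho> z\<close>, hence so is the maximum.\<close>
        moreover have "\<rho> (r z) = 1"
        proof -
          define s where "s = \<rho> z"
          have "\<rho> (r z) = max \<bar>t / s\<bar> ((1 - w b) / s)"
            using bB by (simp add: r_def z s_def) (simp add: \<rho>_def)
          also have "\<dots> = max \<bar>t\<bar> (1 - w b) / \<rho> z"
            using \<open>0 < \<rho> z\<close> by (simp add: s_def max_divide_distrib_right)
          also have "max \<bar>t\<bar> (1 - w b) = \<rho> z" by (simp add: \<rho>_def z)
          finally show ?thesis using \<open>0 < \<rho> z\<close> by simp
        qed
        ultimately show ?thesis
          using order_complex_star_rescale[OF B bB w, of "\<rho> z"]
          unfolding St_def G_def D_def Int_iff mem_Collect_eq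
          by (simp only: r_def z fst_conv snd_conv mem_Times_iff)
      qed
      have rcont: "continuous_map (subtopology (subtopology Z St) {z. 1/2 \<le> \<rho> z})
          (subtopology (subtopology Z St) {z. \<rho> z = 1}) r"
      proof -
        let ?X = "subtopology (subtopology Z St) {z. 1/2 \<le> \<rho> z}"
        have nz: "\<rho> z \<noteq> 0" if "z \<in> topspace ?X" for z using that by auto
        have \<rho>X: "continuous_map ?X euclideanreal \<rho>"
          and fstX: "continuous_map ?X euclideanreal fst"
          by (intro continuous_map_from_subtopology \<rho>cont contfst)+
        have sndX: "continuous_map ?X euclideanreal (\<lambda>z. snd z a)" if "a \<in> B" for a
          by (intro continuous_map_from_subtopology contsnd that)
        have r_top: "r z \<in> St \<inter> D" if "z \<in> topspace ?X" for z
          using that r_St by auto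
        have "continuous_map ?X (top_of_set {-c..c}) (\<lambda>z. fst (r z))"
        proof (rule continuous_map_into_subtopology)
          show "continuous_map ?X euclideanreal (\<lambda>z. fst (r z))"
            unfolding r_def fst_conv by (intro continuous_map_real_divide fstX \<rho>X nz)
          show "(\<lambda>z. fst (r z)) \<in> topspace ?X \<rightarrow> {- c..c}"
            using r_top unfolding St_def G_def by fastforce
        qed
        moreover have "continuous_map ?X K (\<lambda>z. snd (r z))"
          unfolding K_def continuous_map_into_order_complex
        proof (intro conjI ballI)
          show "(\<lambda>z. snd (r z)) \<in> topspace ?X \<rightarrow> topspace (order_complex B le)"
            using r_top unfolding St_def G_def full_subcomplex_def by fastforce
          fix a assume a: "a \<in> B"
          show "continuous_map ?X euclideanreal (\<lambda>z. snd (r z) a)"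
          proof (cases "a = b")
            case True
            have "continuous_map ?X euclideanreal (\<lambda>z. 1 - (1 - snd z b) / \<rho> z)"
              by (intro continuous_map_real_divide continuous_map_diff sndX bB \<rho>X nz
                  continuous_map_canonical_const)
            then show ?thesis using True a by (simp add: r_def)
          next
            case False
            have "continuous_map ?X euclideanreal (\<lambda>z. snd z a / \<rho> z)"
              by (intro continuous_map_real_divide sndX a \<rho>X nz)
            then show ?thesis using False a by (simp add: r_def)
          qed
        qed
        ultimately have "continuous_map ?X Z r"
          unfolding Z_def continuous_map_pairwise o_def by blast
        then show ?thesis
          using r_top by (intro continuous_map_into_subtopology) (auto simp: D_def)
      qed
      have rid: "r z = z" if "z \<in> St" "\<rho> z = 1" for z
      proof -
        obtain t w where z: "z = (t, w)" by (cases z)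
        have "w \<in> extensional B"
          using that z by (auto simp: St_def G_def full_subcomplex_def topspace_order_complex)
        then show ?thesis
          using that(2) unfolding r_def z
          by (auto simp: fun_eq_iff restrict_def extensional_def)
      qed
      have \<rho>1: "\<rho> z \<le> 1" if "z \<in> topspace (subtopology Z St)" for z
        using that abs1 w01 by (cases z) (auto simp: \<rho>_def)
      have Cne: "topspace (subtopology Y (C b)) \<noteq> {}" using sub[OF bB] ne[OF bB] by auto
      \<comment> \<open>Extending \<open>k\<close> inside the contractible subspace
        \<open>C b\<close>, rather than in \<open>Y\<close>, keeps the new map carried.\<close>
      obtain H'' where H''cont: "continuous_map (subtopology Z St) (subtopology Y (C b)) H''"
        and H''k: "\<And>z. z \<in> St \<Longrightarrow> \<rho> z = 1 \<Longrightarrow> H'' z = k z"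
        using contractible_extension[OF continuous_map_from_subtopology[OF \<rho>cont] \<rho>1 rcont _
            kcont[unfolded D_def] contr[OF bB] Cne] rid unfolding topSt by blast
      define H where "H = (\<lambda>z. if z \<in> G V then H' z else H'' z)"
      \<comment> \<open>Where the star meets \<open>G V\<close>, the weight at \<open>b\<close> is
        0. Such points lie on the rim, so there \<open>H''\<close> equals \<open>k\<close>, which
        equals \<open>H'\<close>.\<close>
      have H_St: "H z = H'' z" if "z \<in> St" for z
      proof (cases "z \<in> G V")
        case True
        then have "z \<in> D" using St_V[OF that] D_iff[of "fst z" "snd z"] that Stsub by auto
        then show ?thesis using k_V[OF True] H''k that True by (simp add: H_def D_def)
      qed (simp add: H_def)
      have "continuous_map (subtopology Z (G U)) Y H"
        unfolding H_def
      proof (rule continuous_map_closed_pasting[where T = St])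
        show "closedin (subtopology Z (G U)) (G V)" "closedin (subtopology Z (G U)) St"
          using GU by (simp_all add: closedin_closed_subtopology[OF closedG] closedG St_def)
        show "topspace (subtopology Z (G U)) \<subseteq> G V \<union> St" using cover by auto
        show "continuous_map (subtopology (subtopology Z (G U)) (G V)) Y H'"
          unfolding subtopology_subtopology
          by (rule continuous_map_from_subtopology_mono[OF H'cont]) auto
        show "continuous_map (subtopology (subtopology Z (G U)) St) Y H''"
          unfolding subtopology_subtopology
          by (rule continuous_map_from_subtopology_mono[OF continuous_map_into_fulltopology[OF H''cont]]) auto
        show "H' z = H'' z" if "z \<in> G V" "z \<in> St" for z
          using H_St[OF that(2)] that(1) by (simp add: H_def)
      qed
      moreover have "H (t, w) = h (t, w)" if "(t, w) \<in> G U" "\<bar>t\<bar> = 1" for t w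
      proof (cases "(t, w) \<in> G V")
        case True
        then show ?thesis using H'h that by (simp add: H_def)
      next
        case False
        then have "(t, w) \<in> St" using cover that by blast
        moreover from this have "\<rho> (t, w) = 1" using D_iff[of t w] that Stsub by (auto simp: D_def)
        ultimately show ?thesis using H_St H''k that by (simp add: k_def)
      qed
      \<comment> \<open>For \<open>a\<close> other than \<open>b\<close> the up-set of
        \<open>a\<close> stays inside \<open>V\<close>, so \<open>H\<close> is the previous map
        there; \<open>a = b\<close> is covered by the choice of \<open>H''\<close>.\<close>
      moreover have "H (t, w) \<in> C a" if "a \<in> U" "(t, w) \<in> G (up_set B le a)" for a t w
      proof (cases "a = b")
        case True
        then show ?thesis
          using that H_St continuous_map_image_subset_topspace[OF H''cont] topSt
          by (auto simp: St_def)
      next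
        case False
        then have "a \<in> V" using that by (simp add: V_def)
        moreover from this have "up_set B le a \<subseteq> V" using V by (auto simp: up_set_def)
        then have "(t, w) \<in> G V"
          using that full_subcomplex_mono[of "up_set B le a" B V le] by (auto simp: G_def)
        ultimately show ?thesis using H'C that by (simp add: H_def)
      qed
      ultimately show ?thesis by blast
    qed
  qed
  from this[of B] obtain H where H: "continuous_map (subtopology Z (G B)) Y H"
      "\<And>t w. (t, w) \<in> G B \<Longrightarrow> \<bar>t\<bar> = 1 \<Longrightarrow> H (t, w) = h (t, w)"
      "\<And>b t w. b \<in> B \<Longrightarrow> (t, w) \<in> G (up_set B le b) \<Longrightarrow> H (t, w) \<in> C b"
    by blast
  moreover have GB: "G B = topspace Z" by (simp add: G_def topZ K_def)
  ultimately have "continuous_map Z Y H" by simp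
  then show ?thesis
  proof (rule that)
    show "H (t, w) = h (t, w)" if "t \<in> {-c..c}" "w \<in> topspace K" "\<bar>t\<bar> = 1" for t w
      using H(2)[of t w] that unfolding GB topZ by blast
    show "H (t, w) \<in> C b" if "t \<in> {-c..c}" "b \<in> B" "w \<in> full_subcomplex B le (up_set B le b)" for t w b
      using H(3)[of b t w] that unfolding G_def by blast
  qed
qed

text \<open>The degenerate interval \<open>{-0..0}\<close> is the single point 0 and has no point of
  absolute value 1. The conditions on \<open>h\<close> are thus vacuous, and
  \<open>undefined\<close> can stand for it. Restricting the extension to parameter 0 gives the
  map.\<close>

lemma carried_map_exists:
  assumes "fin_poset B le"
    and "\<And>b. b \<in> B \<Longrightarrow> C b \<subseteq> topspace Y"
    and "\<And>b. b \<in> B \<Longrightarrow> C b \<noteq> {}"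
    and "\<And>b. b \<in> B \<Longrightarrow> contractible_space (subtopology Y (C b))"
    and "\<And>a b. a \<in> B \<Longrightarrow> b \<in> B \<Longrightarrow> le a b \<Longrightarrow> C b \<subseteq> C a"
  obtains k where "continuous_map (order_complex B le) Y k"
    "\<And>w b. b \<in> B \<Longrightarrow> w \<in> full_subcomplex B le (up_set B le b) \<Longrightarrow> k w \<in> C b"
proof -
  have empty: "subtopology (prod_topology (top_of_set {-0..0}) (order_complex B le)) {z. \<bar>fst z\<bar> = (1::real)}
      = trivial_topology"
    by (subst null_topspace_iff_trivial[symmetric]) auto
  obtain H where H: "continuous_map (prod_topology (top_of_set {-0..0::real}) (order_complex B le)) Y H"
    "\<And>t w b. t \<in> {-0..0} \<Longrightarrow> b \<in> B \<Longrightarrow> w \<in> full_subcomplex B le (up_set B le b) \<Longrightarrow> H (t, w) \<in> C b"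
    by (rule carrier_extension[of 0 B le C Y undefined])
       (use assms empty in \<open>auto simp: continuous_map_on_empty\<close>)
  have "continuous_map (order_complex B le) (prod_topology (top_of_set {-0..0::real}) (order_complex B le)) (\<lambda>w. (0, w))"
    by (intro continuous_map_pairedI) auto
  from continuous_map_compose[OF this H(1)] have "continuous_map (order_complex B le) Y (\<lambda>w. H (0, w))"
    by (simp add: o_def)
  then show ?thesis using that H(2) by auto
qed

text \<open>Over \<open>[-1, 1]\<close> the ends are prescribed as \<open>f\<close> and
  \<open>g\<close>; the extension between them is the homotopy.\<close>

lemma carried_maps_homotopic:
  assumes "fin_poset B le"
    and "\<And>b. b \<in> B \<Longrightarrow> C b \<subseteq> topspace Y"
    and "\<And>b. b \<in> B \<Longrightarrow> contractible_space (subtopology Y (C b))"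
    and "\<And>a b. a \<in> B \<Longrightarrow> b \<in> B \<Longrightarrow> le a b \<Longrightarrow> C b \<subseteq> C a"
    and f: "continuous_map (order_complex B le) Y f"
    and g: "continuous_map (order_complex B le) Y g"
    and fC: "\<And>w b. b \<in> B \<Longrightarrow> w \<in> full_subcomplex B le (up_set B le b) \<Longrightarrow> f w \<in> C b"
    and gC: "\<And>w b. b \<in> B \<Longrightarrow> w \<in> full_subcomplex B le (up_set B le b) \<Longrightarrow> g w \<in> C b"
  shows "homotopic_with (\<lambda>x. True) (order_complex B le) Y f g"
proof -
  let ?K = "order_complex B le"
  let ?Z = "prod_topology (top_of_set {-1..1::real}) ?K"
  \<comment> \<open>On the ends \<open>fst z\<close> is -1 or 1, so the two cases never meet at 0
    and compatibility there is vacuous.\<close>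
  define h where "h = (\<lambda>z::real \<times> _. if fst z \<le> 0 then f (snd z) else g (snd z))"
  \<comment> \<open>The value of \<open>f\<close> at the vertex \<open>b\<close> lies in
    \<open>C b\<close>.\<close>
  have C_ne: "C b \<noteq> {}" if "b \<in> B" for b
  proof -
    have "(\<lambda>a\<in>B. if a = b then 1 else 0) \<in> full_subcomplex B le (up_set B le b)"
    proof -
      have "finite B" "le b b" using assms(1) that by (auto simp: fin_poset_def)
      then show ?thesis
        using that by (auto simp: full_subcomplex_def topspace_order_complex up_set_def is_chain_def)
    qed
    from fC[OF that this] show ?thesis by blast
  qed
  have h: "continuous_map (subtopology ?Z {z. \<bar>fst z\<bar> = 1}) Y h"
  proof -
    let ?X = "subtopology ?Z {z. \<bar>fst z\<bar> = 1}"
    have fs: "continuous_map ?X Y (\<lambda>z. f (snd z))" "continuous_map ?X Y (\<lambda>z. g (snd z))"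
      using continuous_map_compose[OF continuous_map_snd f] continuous_map_compose[OF continuous_map_snd g]
      by (auto simp: o_def intro!: continuous_map_from_subtopology)
    have "continuous_map ?X euclideanreal fst"
      using continuous_map_fst continuous_map_into_fulltopology continuous_map_from_subtopology by blast
    then show ?thesis
      unfolding h_def
      by (intro continuous_map_cases_le fs[THEN continuous_map_from_subtopology]) auto
  qed
  obtain H where H: "continuous_map ?Z Y H"
    "\<And>t w. t \<in> {-1..1} \<Longrightarrow> w \<in> topspace ?K \<Longrightarrow> \<bar>t\<bar> = 1 \<Longrightarrow> H (t, w) = h (t, w)"
    by (rule carrier_extension[of 1 B le C Y h])
       (use assms C_ne h in \<open>auto simp: h_def\<close>)
  let ?I = "prod_topology (top_of_set {0..1::real}) ?K"
  have "continuous_map ?I euclideanreal fst"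
    using continuous_map_fst continuous_map_into_fulltopology by blast
  \<comment> \<open>Time is reparametrised from the unit interval, which
    \<open>homotopic_with\<close> uses, to \<open>[-1, 1]\<close>.\<close>
  then have "continuous_map ?I (top_of_set {-1..1}) (\<lambda>z. 2 * fst z - 1)"
    by (intro continuous_map_into_subtopology continuous_map_diff continuous_map_real_mult_left
        continuous_map_canonical_const) auto
  then have "continuous_map ?I ?Z (\<lambda>z. (2 * fst z - 1, snd z))"
    by (intro continuous_map_pairedI continuous_map_snd)
  from continuous_map_compose[OF this H(1)]
  have "homotopic_with (\<lambda>x. True) ?K Y (\<lambda>w. H (-1, w)) (\<lambda>w. H (1, w))"
    unfolding homotopic_with_def by (intro exI conjI) (auto simp: o_def)
  then show ?thesis
    by (rule homotopic_with_eq) (auto simp: H(2) h_def)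
qed

section \<open>Cones and subcomplexes of subposets\<close>

text \<open>The straight line towards the vertex \<open>b\<close> stays in the subcomplex:
  \<open>b\<close> lies below all of \<open>U\<close>, so adding it to the support of a point leaves
  a chain in \<open>U\<close>.\<close>

lemma contractible_space_order_complex_least:
  assumes B: "fin_poset B le" and b: "b \<in> B" and U: "U \<subseteq> up_set B le b" "b \<in> U"
  shows "contractible_space (subtopology (order_complex B le) (full_subcomplex B le U))"
proof -
  have fin: "finite B" using B by (simp add: fin_poset_def)
  let ?K = "subtopology (order_complex B le) (full_subcomplex B le U)"
  let ?I = "prod_topology (top_of_set {0..1::real}) ?K"
  define d where "d = (\<lambda>a\<in>B. if a = b then 1 else 0::real)"
  \<comment> \<open>\<open>homotopic_with\<close> fixes the values at times 0 and 1 for all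
    arguments, even for functions outside the complex. The separate cases supply these; on the
    subcomplex they agree with the line segment.\<close>
  define H where "H = (\<lambda>z. if fst z = (0::real) then snd z else if fst z = 1 then d else
     (\<lambda>a\<in>B. (1 - fst z) * snd z a + fst z * d a))"
  have H: "H (t, w) = (\<lambda>a\<in>B. (1 - t) * w a + t * d a)" if "w \<in> full_subcomplex B le U" for t w
    using that by (auto simp: H_def d_def fun_eq_iff full_subcomplex_def topspace_order_complex extensional_def)
  have H_in: "H (t, w) \<in> full_subcomplex B le U" if t: "t \<in> {0..1}" and w: "w \<in> full_subcomplex B le U" for t w
  proof -
    let ?v = "\<lambda>a\<in>B. (1 - t) * w a + t * d a"
    have w': "w \<in> topspace (order_complex B le)" using w by (simp add: full_subcomplex_def)
    have "(\<Sum>a\<in>B. ?v a) = (1 - t) * (\<Sum>a\<in>B. w a) + t * (\<Sum>a\<in>B. d a)"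
      by (simp add: sum.distrib sum_distrib_left)
    also have "(\<Sum>a\<in>B. d a) = 1" using fin b by (simp add: d_def)
    finally have sum: "(\<Sum>a\<in>B. ?v a) = 1" using w' by (simp add: topspace_order_complex)
    have supp: "a = b \<or> w a \<noteq> 0" if "a \<in> B" "?v a \<noteq> 0" for a
      using that by (auto simp: d_def split: if_splits)
    have vU: "a \<in> U" if "a \<in> B" "?v a \<noteq> 0" for a
      using supp[OF that] that w U(2) by (auto simp: full_subcomplex_def)
    have "is_chain {a\<in>B. ?v a \<noteq> 0} le"
      unfolding is_chain_def
    proof (intro ballI)
      fix x y assume xy: "x \<in> {a\<in>B. ?v a \<noteq> 0}" "y \<in> {a\<in>B. ?v a \<noteq> 0}"
      have bxy: "le b x" "le b y" using xy vU U(1) unfolding up_set_def by blast+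
      show "le x y \<or> le y x"
      proof (cases "x = b \<or> y = b")
        case True
        then show ?thesis using bxy by auto
      next
        case False
        then have "x \<in> {a\<in>B. w a \<noteq> 0}" "y \<in> {a\<in>B. w a \<noteq> 0}" using xy supp by blast+
        then show ?thesis using w' unfolding topspace_order_complex is_chain_def by blast
      qed
    qed
    moreover have "0 \<le> ?v a" if "a \<in> B" for a
      using t w' that by (auto simp: topspace_order_complex d_def)
    ultimately show ?thesis
      using sum vU unfolding H[OF w] full_subcomplex_def topspace_order_complex by blast
  qed
  have top: "topspace ?I = {0..1} \<times> full_subcomplex B le U"
    using full_subcomplex_subset_topspace[of B le U] by auto
  have "continuous_map ?I (order_complex B le) H"
    unfolding continuous_map_into_order_complex
  proof (intro conjI ballI)
    show "H \<in> topspace ?I \<rightarrow> topspace (order_complex B le)"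
      using H_in full_subcomplex_subset_topspace[of B le U] unfolding top by fast
    fix a assume a: "a \<in> B"
    have t: "continuous_map ?I euclideanreal fst"
      using continuous_map_fst continuous_map_into_fulltopology by blast
    have "continuous_map ?I (order_complex B le) snd"
      using continuous_map_snd continuous_map_into_fulltopology by blast
    from continuous_map_compose[OF this continuous_map_order_complex_eval[OF a]]
    have w: "continuous_map ?I euclideanreal (\<lambda>z. snd z a)" by (simp add: o_def)
    have "continuous_map ?I euclideanreal (\<lambda>z. (1 - fst z) * snd z a + fst z * d a)"
      by (intro continuous_map_add continuous_map_diff continuous_map_real_mult t w continuous_map_canonical_const)
    then show "continuous_map ?I euclideanreal (\<lambda>z. H z a)"
      by (rule continuous_map_eq) (use H a top in auto)
  qed
  then have "continuous_map ?I ?K H"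
    by (rule continuous_map_into_subtopology) (use H_in top in auto)
  then show ?thesis
    unfolding contractible_space_def homotopic_with_def
    by (intro exI[of _ d] exI[of _ H]) (auto simp: H_def)
qed

text \<open>Extension by zero and restriction to \<open>U\<close> are mutually inverse, and
  continuous in every coordinate. This transports contractibility from the order complex of a
  subposet to the subspace of the ambient complex that serves as a carrier.\<close>

lemma order_complex_homeomorphic_full_subcomplex:
  assumes "finite A" "U \<subseteq> A"
  shows "order_complex U le homeomorphic_space
         subtopology (order_complex A le) (full_subcomplex A le U)"
proof -
  let ?K = "subtopology (order_complex A le) (full_subcomplex A le U)"
  define i where "i = (\<lambda>w::_ \<Rightarrow> real. \<lambda>a\<in>A. if a \<in> U then w a else 0)"
  have i_in: "i w \<in> full_subcomplex A le U" if "w \<in> topspace (order_complex U le)" for w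
  proof -
    have "(\<Sum>a\<in>A. i w a) = (\<Sum>a\<in>U. w a)"
      using assms by (intro sum.mono_neutral_cong_right) (auto simp: i_def)
    moreover have "{a\<in>A. i w a \<noteq> 0} = {a\<in>U. w a \<noteq> 0}"
      using assms by (auto simp: i_def)
    moreover have "i w \<in> extensional A" "\<And>a. a \<in> A \<Longrightarrow> a \<notin> U \<Longrightarrow> i w a = 0"
      by (auto simp: i_def)
    moreover have "0 \<le> i w a" if "a \<in> A" for a
      using \<open>w \<in> _\<close> that by (auto simp: i_def topspace_order_complex)
    ultimately show ?thesis
      using that by (simp add: full_subcomplex_def topspace_order_complex)
  qed
  have r_in: "restrict w U \<in> topspace (order_complex U le)" if "w \<in> full_subcomplex A le U" for w
  proof -
    have "(\<Sum>a\<in>A. w a) = (\<Sum>a\<in>U. restrict w U a)"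
      using assms that by (intro sum.mono_neutral_cong_right) (auto simp: full_subcomplex_def)
    moreover have "{a\<in>A. w a \<noteq> 0} = {a\<in>U. restrict w U a \<noteq> 0}"
      using assms that by (auto simp: full_subcomplex_def)
    ultimately show ?thesis
      using that assms(2) by (auto simp: full_subcomplex_def topspace_order_complex)
  qed
  have "continuous_map (order_complex U le) (order_complex A le) i"
    unfolding continuous_map_into_order_complex
  proof (intro conjI ballI)
    show "i \<in> topspace (order_complex U le) \<rightarrow> topspace (order_complex A le)"
      using i_in full_subcomplex_subset_topspace[of A le U] by blast
    show "continuous_map (order_complex U le) euclideanreal (\<lambda>w. i w a)" if "a \<in> A" for a
      using that by (cases "a \<in> U") (auto simp: i_def intro: continuous_map_order_complex_eval)
  qed
  then have "continuous_map (order_complex U le) ?K i"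
    by (rule continuous_map_into_subtopology) (use i_in in auto)
  moreover have "continuous_map ?K (order_complex U le) (\<lambda>w. restrict w U)"
    unfolding continuous_map_into_order_complex
  proof (intro conjI ballI)
    show "(\<lambda>w. restrict w U) \<in> topspace ?K \<rightarrow> topspace (order_complex U le)"
      using r_in by auto
    show "continuous_map ?K euclideanreal (\<lambda>w. restrict w U a)" if "a \<in> U" for a
      using that assms by (auto intro!: continuous_map_from_subtopology continuous_map_order_complex_eval)
  qed
  moreover have "restrict (i w) U = w" if "w \<in> topspace (order_complex U le)" for w
    using that assms(2) by (auto simp: i_def fun_eq_iff topspace_order_complex extensional_def)
  moreover have "i (restrict w U) = w" if "w \<in> topspace ?K" for w
    using that assms(2)
    by (auto simp: i_def fun_eq_iff full_subcomplex_def topspace_order_complex extensional_def)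
  ultimately show ?thesis
    unfolding homeomorphic_space_def homeomorphic_maps_def by blast
qed

section \<open>Simplicial maps induced by order-preserving maps\<close>

text \<open>Nonnegative weights cannot cancel in the fibre sums, so the support of the image is the
  image of the support.\<close>

lemma realize_map_nonzero_iff:
  assumes "finite A" "w \<in> topspace (order_complex A le)" "b \<in> B"
  shows "realize_map A B g w b \<noteq> 0 \<longleftrightarrow> (\<exists>a\<in>A. g a = b \<and> w a \<noteq> 0)"
proof -
  have "(\<Sum>a\<in>{a\<in>A. g a = b}. w a) = 0 \<longleftrightarrow> (\<forall>a\<in>{a\<in>A. g a = b}. w a = 0)"
    using assms by (intro sum_nonneg_eq_0_iff) (auto simp: topspace_order_complex)
  then show ?thesis using assms(3) by (auto simp: realize_map_def)
qed

text \<open>Summing over the fibres of \<open>g\<close> keeps the total weight, and \<open>g\<close>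
  maps the chain supporting \<open>w\<close> to a chain. Keeping track of \<open>U\<close> and
  \<open>V\<close> serves to check that induced maps are carried; \<open>U = A\<close> and
  \<open>V = B\<close> give well-definedness.\<close>

lemma realize_map_in_full_subcomplex:
  assumes "finite A" "finite B" and g: "order_preserving A leA B leB g"
    and w: "w \<in> full_subcomplex A leA U" and gU: "\<And>a. a \<in> A \<Longrightarrow> a \<in> U \<Longrightarrow> g a \<in> V"
  shows "realize_map A B g w \<in> full_subcomplex B leB V"
proof -
  let ?v = "realize_map A B g w"
  have w': "w \<in> topspace (order_complex A leA)" using w by (simp add: full_subcomplex_def)
  note nz = realize_map_nonzero_iff[OF assms(1) w', of _ B g]
  have "(\<Sum>b\<in>B. ?v b) = (\<Sum>b\<in>B. \<Sum>a\<in>{a\<in>A. g a = b}. w a)"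
    by (simp add: realize_map_def)
  also have "\<dots> = (\<Sum>a\<in>A. w a)"
    using assms(1,2) g by (intro sum.group) (auto simp: order_preserving_def)
  finally have "(\<Sum>b\<in>B. ?v b) = 1" using w' by (simp add: topspace_order_complex)
  moreover have "is_chain {b\<in>B. ?v b \<noteq> 0} leB"
    unfolding is_chain_def
  proof (intro ballI)
    fix x y assume xy: "x \<in> {b\<in>B. ?v b \<noteq> 0}" "y \<in> {b\<in>B. ?v b \<noteq> 0}"
    obtain a where a: "a \<in> A" "g a = x" "w a \<noteq> 0" using nz xy by blast
    obtain a' where a': "a' \<in> A" "g a' = y" "w a' \<noteq> 0" using nz xy by blast
    have "leA a a' \<or> leA a' a"
      using a a' w' unfolding topspace_order_complex is_chain_def by blast
    then show "leB x y \<or> leB y x" using a a' g unfolding order_preserving_def by blast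
  qed
  moreover have "0 \<le> ?v b" if "b \<in> B" for b
    using that w' by (auto simp: realize_map_def topspace_order_complex intro!: sum_nonneg)
  moreover have "?v \<in> extensional B" by (simp add: realize_map_def)
  moreover have "?v b = 0" if "b \<in> B" "b \<notin> V" for b
    using nz[OF that(1)] that gU w by (auto simp: full_subcomplex_def)
  ultimately show ?thesis
    unfolding full_subcomplex_def topspace_order_complex by blast
qed

lemma continuous_map_realize_map:
  assumes "finite A" "finite B" "order_preserving A leA B leB g"
  shows "continuous_map (order_complex A leA) (order_complex B leB) (realize_map A B g)"
  unfolding continuous_map_into_order_complex
proof (intro conjI ballI)
  show "realize_map A B g \<in> topspace (order_complex A leA) \<rightarrow> topspace (order_complex B leB)"
    using realize_map_in_full_subcomplex[OF assms, of _ A B] assms(3)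
    by (auto simp: order_preserving_def)
  fix b assume "b \<in> B"
  then show "continuous_map (order_complex A leA) euclideanreal (\<lambda>w. realize_map A B g w b)"
    using assms(1) by (auto simp: realize_map_def intro!: continuous_map_sum continuous_map_order_complex_eval)
qed

text \<open>Functoriality: the fibre of the composite over \<open>c\<close> splits into the fibres
  of \<open>g\<close> over the elements that \<open>g'\<close> sends to \<open>c\<close>.\<close>

lemma realize_map_compose:
  assumes "finite A" "finite B" "\<And>a. a \<in> A \<Longrightarrow> g a \<in> B"
  shows "realize_map B C g' (realize_map A B g w) = realize_map A C (g' \<circ> g) w"
proof
  fix c
  have "(\<Sum>b\<in>{b\<in>B. g' b = c}. \<Sum>a\<in>{a\<in>A. g a = b}. w a)
      = (\<Sum>b\<in>{b\<in>B. g' b = c}. \<Sum>a\<in>{a\<in>{a\<in>A. g' (g a) = c}. g a = b}. w a)"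
    by (intro sum.cong) auto
  also have "\<dots> = (\<Sum>a\<in>{a\<in>A. g' (g a) = c}. w a)"
    using assms by (intro sum.group) auto
  finally show "realize_map B C g' (realize_map A B g w) c = realize_map A C (g' \<circ> g) w c"
    by (simp add: realize_map_def restrict_def)
qed

lemma realize_map_ident:
  assumes "w \<in> topspace (order_complex A le)" "\<And>a. a \<in> A \<Longrightarrow> g a = a"
  shows "realize_map A A g w = w"
proof
  fix b
  have "{a\<in>A. g a = b} = (if b \<in> A then {b} else {})" using assms(2) by auto
  then show "realize_map A A g w b = w b"
    using assms(1) by (auto simp: realize_map_def topspace_order_complex extensional_def)
qed

lemma fin_poset_refl: "fin_poset A le \<Longrightarrow> a \<in> A \<Longrightarrow> le a a"
  by (simp add: fin_poset_def)

lemma up_set_antimono: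
  assumes "fin_poset B le" "a \<in> B" "b \<in> B" "le a b"
  shows "up_set B le b \<subseteq> up_set B le a"
  using assms unfolding fin_poset_def up_set_def by blast

text \<open>Both maps share a carrier: it assigns to \<open>a\<close> the complex on the elements
  above \<open>f a\<close>, a cone with apex \<open>f a\<close>. If \<open>a'\<close> lies above
  \<open>a\<close>, then \<open>f a \<le> f a' \<le> g a'\<close>, so both images stay in that
  cone.\<close>

lemma realize_map_homotopic:
  assumes A: "fin_poset A leA" and B: "fin_poset B leB"
    and f: "order_preserving A leA B leB f" and g: "order_preserving A leA B leB g"
    and le: "\<And>a. a \<in> A \<Longrightarrow> leB (f a) (g a)"
  shows "homotopic_with (\<lambda>x. True) (order_complex A leA) (order_complex B leB)
           (realize_map A B f) (realize_map A B g)"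
proof (rule carried_maps_homotopic[OF A, where C = "\<lambda>a. full_subcomplex B leB (up_set B leB (f a))"])
  have fin: "finite A" "finite B" using A B by (auto simp: fin_poset_def)
  have trans: "\<And>x y z. x \<in> B \<Longrightarrow> y \<in> B \<Longrightarrow> z \<in> B \<Longrightarrow> leB x y \<Longrightarrow> leB y z \<Longrightarrow> leB x z"
    using B unfolding fin_poset_def by blast
  have fB: "f a \<in> B" "g a \<in> B" if "a \<in> A" for a
    using f g that by (auto simp: order_preserving_def)
  have mono: "leB (f a) (f a')" if "a \<in> A" "a' \<in> A" "leA a a'" for a a'
    using f that by (auto simp: order_preserving_def)
  show "full_subcomplex B leB (up_set B leB (f a)) \<subseteq> topspace (order_complex B leB)" for a
    by (rule full_subcomplex_subset_topspace)
  show "contractible_space (subtopology (order_complex B leB)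
      (full_subcomplex B leB (up_set B leB (f a))))" if "a \<in> A" for a
    using fB(1)[OF that] fin_poset_refl[OF B]
    by (intro contractible_space_order_complex_least[OF B]) (auto simp: up_set_def)
  show "full_subcomplex B leB (up_set B leB (f b)) \<subseteq> full_subcomplex B leB (up_set B leB (f a))"
    if "a \<in> A" "b \<in> A" "leA a b" for a b
    by (intro full_subcomplex_mono le_infI1 up_set_antimono[OF B] fB mono that)
  show "continuous_map (order_complex A leA) (order_complex B leB) (realize_map A B f)"
    "continuous_map (order_complex A leA) (order_complex B leB) (realize_map A B g)"
    using fin f g continuous_map_realize_map by blast+
  fix w a assume a: "a \<in> A" and w: "w \<in> full_subcomplex A leA (up_set A leA a)"
  show "realize_map A B f w \<in> full_subcomplex B leB (up_set B leB (f a))"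
    by (rule realize_map_in_full_subcomplex[OF fin f w]) (use fB mono a in \<open>auto simp: up_set_def\<close>)
  have "leB (f a) (g a')" if "a' \<in> A" "leA a a'" for a'
    using trans[OF _ _ _ mono[OF a that] le[OF that(1)]] fB a that by blast
  then show "realize_map A B g w \<in> full_subcomplex B leB (up_set B leB (f a))"
    by (intro realize_map_in_full_subcomplex[OF fin g w]) (use fB in \<open>auto simp: up_set_def\<close>)
qed

section \<open>Retracts and Quillen's fibre lemma\<close>

text \<open>Since \<open>i \<circ> r\<close> lies below the identity of \<open>D\<close>, it induces
  a map homotopic to the identity, while \<open>r \<circ> i\<close> is the identity of
  \<open>E\<close>. The two order complexes are therefore homotopy equivalent.\<close>

lemma homotopically_trivial_retract_below:
  assumes D: "fin_poset D leD" and E: "fin_poset E leE"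
    and i: "order_preserving E leE D leD i" and r: "order_preserving D leD E leE r"
    and ri: "\<And>e. e \<in> E \<Longrightarrow> r (i e) = e" and ir: "\<And>d. d \<in> D \<Longrightarrow> leD (i (r d)) d"
    and triv: "homotopically_trivial E leE"
  shows "homotopically_trivial D leD"
proof -
  have fin: "finite D" "finite E" using D E by (auto simp: fin_poset_def)
  let ?i = "realize_map E D i" and ?r = "realize_map D E r"
  have ci: "continuous_map (order_complex E leE) (order_complex D leD) ?i"
    and cr: "continuous_map (order_complex D leD) (order_complex E leE) ?r"
    using continuous_map_realize_map fin i r by blast+
  have "homotopic_with (\<lambda>x. True) (order_complex D leD) (order_complex D leD)
      (realize_map D D (i \<circ> r)) (realize_map D D id)"
    using i r ir by (intro realize_map_homotopic D) (auto simp: order_preserving_def)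
  then have "homotopic_with (\<lambda>x. True) (order_complex D leD) (order_complex D leD) (?i \<circ> ?r) id"
    by (rule homotopic_with_eq)
      (use r fin in \<open>auto simp: realize_map_compose order_preserving_def realize_map_ident\<close>)
  moreover have "homotopic_with (\<lambda>x. True) (order_complex E leE) (order_complex E leE) (?r \<circ> ?i) id"
    by (rule homotopic_with_equal[OF _ _ continuous_map_compose[OF ci cr]])
      (use i fin ri in \<open>auto simp: realize_map_compose order_preserving_def realize_map_ident\<close>)
  ultimately have "order_complex D leD homotopy_equivalent_space order_complex E leE"
    using ci cr unfolding homotopy_equivalent_space_def by blast
  \<comment> \<open>Contractibility alone would allow an empty complex, so nonemptiness is
    transferred separately along the map induced by \<open>i\<close>.\<close>
  moreover have "topspace (order_complex D leD) \<noteq> {}"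
    using triv continuous_map_funspace[OF ci] unfolding homotopically_trivial_def by blast
  ultimately show ?thesis
    using triv homotopy_equivalent_space_contractibility by (auto simp: homotopically_trivial_def)
qed

text \<open>The homotopy inverse comes from the carrier sending \<open>b\<close> to the complex on
  its upper fibre, which is contractible by assumption and shrinks as \<open>b\<close> grows.
  Uniqueness of carried maps up to homotopy then identifies both composites with identities.\<close>

theorem quillen_fiber_lemma:
  assumes A: "fin_poset A leA" and B: "fin_poset B leB" and g: "order_preserving A leA B leB g"
    and triv: "\<And>b. b \<in> B \<Longrightarrow> homotopically_trivial {a\<in>A. g a \<in> up_set B leB b} leA"
  shows "weak_equivalence A leA B leB g"
proof -
  have fin: "finite A" "finite B" using A B by (auto simp: fin_poset_def)
  have gB: "g a \<in> B" if "a \<in> A" for a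
    using g that by (auto simp: order_preserving_def)
  have mono: "leB (g a) (g a')" if "a \<in> A" "a' \<in> A" "leA a a'" for a a'
    using g that by (auto simp: order_preserving_def)
  let ?KA = "order_complex A leA" and ?KB = "order_complex B leB"
  define C where "C = (\<lambda>b. full_subcomplex A leA {a\<in>A. g a \<in> up_set B leB b})"
  have C_sub: "C b \<subseteq> topspace ?KA" for b
    unfolding C_def by (rule full_subcomplex_subset_topspace)
  have C_contr: "contractible_space (subtopology ?KA (C b))" and C_ne: "C b \<noteq> {}" if "b \<in> B" for b
  proof -
    have hs: "order_complex {a\<in>A. g a \<in> up_set B leB b} leA homeomorphic_space subtopology ?KA (C b)"
      unfolding C_def by (intro order_complex_homeomorphic_full_subcomplex fin) auto
    show "contractible_space (subtopology ?KA (C b))"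
      using triv[OF that] homeomorphic_space_contractibility[OF hs]
      by (simp add: homotopically_trivial_def)
    show "C b \<noteq> {}"
    proof
      assume "C b = {}"
      then have "subtopology ?KA (C b) = trivial_topology" by simp
      then show False
        using triv[OF that] homeomorphic_empty_space[OF hs] by (simp add: homotopically_trivial_def)
    qed
  qed
  have C_anti: "C b \<subseteq> C a" if "a \<in> B" "b \<in> B" "leB a b" for a b
    unfolding C_def using up_set_antimono[OF B that] by (intro full_subcomplex_mono) blast
  obtain k where k: "continuous_map ?KB ?KA k"
    and kC: "\<And>w b. b \<in> B \<Longrightarrow> w \<in> full_subcomplex B leB (up_set B leB b) \<Longrightarrow> k w \<in> C b"
    using carried_map_exists[OF B, of C ?KA] C_sub C_ne C_contr C_anti by blast
  let ?g = "realize_map A B g"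
  have cg: "continuous_map ?KA ?KB ?g"
    by (rule continuous_map_realize_map[OF fin g])
  have "homotopic_with (\<lambda>x. True) ?KA ?KA (k \<circ> ?g) id"
  \<comment> \<open>The common carrier of \<open>k \<circ> ?g\<close> and the identity is
    \<open>C (g a)\<close>, as the elements above \<open>a\<close> map above
    \<open>g a\<close>.\<close>
  proof (rule carried_maps_homotopic[OF A, where C = "\<lambda>a. C (g a)"])
    fix w a assume a: "a \<in> A" and w: "w \<in> full_subcomplex A leA (up_set A leA a)"
    have "?g w \<in> full_subcomplex B leB (up_set B leB (g a))"
      by (rule realize_map_in_full_subcomplex[OF fin g w]) (use gB mono a in \<open>auto simp: up_set_def\<close>)
    then show "(k \<circ> ?g) w \<in> C (g a)" using kC gB a by auto
    have "full_subcomplex A leA (up_set A leA a) \<subseteq> C (g a)"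
      unfolding C_def using gB mono a by (intro full_subcomplex_mono) (auto simp: up_set_def)
    then show "id w \<in> C (g a)" using w by auto
  qed (use C_sub C_contr C_anti gB mono continuous_map_compose[OF cg k] in auto)
  moreover have "homotopic_with (\<lambda>x. True) ?KB ?KB (?g \<circ> k) id"
  \<comment> \<open>The carrier is now the cone above \<open>b\<close>: \<open>k\<close> sends it
    into the upper fibre of \<open>b\<close>, which \<open>g\<close> maps back above
    \<open>b\<close>.\<close>
  proof (rule carried_maps_homotopic[OF B, where C = "\<lambda>b. full_subcomplex B leB (up_set B leB b)"])
    show "contractible_space (subtopology ?KB (full_subcomplex B leB (up_set B leB b)))"
      if "b \<in> B" for b
      using that fin_poset_refl[OF B]
      by (intro contractible_space_order_complex_least[OF B]) (auto simp: up_set_def)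
    show "full_subcomplex B leB (up_set B leB b) \<subseteq> full_subcomplex B leB (up_set B leB a)"
      if "a \<in> B" "b \<in> B" "leB a b" for a b
      by (intro full_subcomplex_mono le_infI1 up_set_antimono[OF B] that)
    show "(?g \<circ> k) w \<in> full_subcomplex B leB (up_set B leB b)"
      if "b \<in> B" "w \<in> full_subcomplex B leB (up_set B leB b)" for w b
      using realize_map_in_full_subcomplex[OF fin g kC[OF that, unfolded C_def]] by simp
  qed (use continuous_map_compose[OF k cg] full_subcomplex_subset_topspace in auto)
  ultimately show ?thesis
    using g cg k unfolding weak_equivalence_def homotopy_equivalence_map_def by blast
qed

section \<open>Homotopy colimits of diagrams of posets\<close>

lemma fin_poset_subset: "fin_poset A le \<Longrightarrow> U \<subseteq> A \<Longrightarrow> fin_poset U le"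
  unfolding fin_poset_def by (meson finite_subset subset_iff)

text \<open>For antisymmetry the indices agree first, and since \<open>f q q\<close> is the identity
  the rest happens in \<open>X q\<close>. For transitivity, monotonicity of \<open>f q' q''\<close>
  gives \<open>f q' q'' (f q q' x) \<le> f q' q'' x'\<close>, and functoriality turns the left side
  into \<open>f q q'' x\<close>.\<close>

lemma fin_poset_hocolim:
  assumes Q: "fin_poset Q leQ" and X: "poset_diagram Q leQ X leX f"
  shows "fin_poset (hocolim_set Q X) (hocolim_le leQ leX f)"
proof -
  have Xq: "fin_poset (X q) (leX q)" if "q \<in> Q" for q
    using X that by (simp add: poset_diagram_def)
  have f_mono: "order_preserving (X q) (leX q) (X q') (leX q') (f q q')"
    if "q \<in> Q" "q' \<in> Q" "leQ q q'" for q q'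
    using X that by (simp add: poset_diagram_def)
  have f_id: "f q q x = x" if "q \<in> Q" "x \<in> X q" for q x
    using X that by (simp add: poset_diagram_def)
  have f_comp: "f q' q'' (f q q' x) = f q q'' x"
    if "q \<in> Q" "q' \<in> Q" "q'' \<in> Q" "leQ q q'" "leQ q' q''" "x \<in> X q" for q q' q'' x
    using X that unfolding poset_diagram_def by blast
  have fin: "finite (Sigma Q X)"
    using Q Xq by (intro finite_SigmaI) (auto simp: fin_poset_def)
  have refl: "hocolim_le leQ leX f (q, x) (q, x)" if "q \<in> Q" "x \<in> X q" for q x
    using that Q Xq[OF that(1)] f_id[OF that] by (simp add: hocolim_le_def fin_poset_def)
  have antisym: "q = q' \<and> x = x'"
    if "q \<in> Q" "x \<in> X q" "q' \<in> Q" "x' \<in> X q'"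
      and le: "hocolim_le leQ leX f (q, x) (q', x')" "hocolim_le leQ leX f (q', x') (q, x)" for q x q' x'
  proof -
    have "q = q'" using that Q unfolding hocolim_le_def fin_poset_def fst_conv by blast
    moreover from this have "x = x'"
    proof -
      have "leX q x x'" "leX q x' x" "x' \<in> X q"
        using le \<open>q = q'\<close> that(1-4) f_id by (simp_all add: hocolim_le_def)
      then show ?thesis using Xq[OF \<open>q \<in> Q\<close>] \<open>x \<in> X q\<close> unfolding fin_poset_def by blast
    qed
    ultimately show ?thesis ..
  qed
  have trans: "hocolim_le leQ leX f (q, x) (q'', x'')"
    if q: "q \<in> Q" "x \<in> X q" "q' \<in> Q" "x' \<in> X q'" "q'' \<in> Q" "x'' \<in> X q''"
      and le: "hocolim_le leQ leX f (q, x) (q', x')" "hocolim_le leQ leX f (q', x') (q'', x'')"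
    for q x q' x' q'' x''
  proof -
    have le': "leQ q q'" "leQ q' q''" "leX q' (f q q' x) x'" "leX q'' (f q' q'' x') x''"
      using le by (simp_all add: hocolim_le_def)
    have "leQ q q''" using Q q le' unfolding fin_poset_def by blast
    have in': "f q q' x \<in> X q'" "f q' q'' x' \<in> X q''" "f q q'' x \<in> X q''"
      using f_mono q le' \<open>leQ q q''\<close> by (auto simp: order_preserving_def)
    have "leX q'' (f q' q'' (f q q' x)) (f q' q'' x')"
      using f_mono[of q' q''] q le' in' by (simp add: order_preserving_def)
    then have "leX q'' (f q q'' x) (f q' q'' x')" using f_comp q le' by simp
    then have "leX q'' (f q q'' x) x''"
      using Xq[OF \<open>q'' \<in> Q\<close>] le' in' q unfolding fin_poset_def by blast
    with \<open>leQ q q''\<close> show ?thesis by (simp add: hocolim_le_def)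
  qed
  show ?thesis
    unfolding fin_poset_def hocolim_set_def
  proof (intro conjI ballI impI)
    show "a = b" if "a \<in> Sigma Q X" "b \<in> Sigma Q X"
      "hocolim_le leQ leX f a b \<and> hocolim_le leQ leX f b a" for a b
      using that antisym[of "fst a" "snd a" "fst b" "snd b"] by (auto simp: prod_eq_iff)
    show "hocolim_le leQ leX f a c" if "a \<in> Sigma Q X" "b \<in> Sigma Q X" "c \<in> Sigma Q X"
      "hocolim_le leQ leX f a b \<and> hocolim_le leQ leX f b c" for a b c
      using that trans[of "fst a" "snd a" "fst b" "snd b" "fst c" "snd c"] by auto
  qed (use fin refl in auto)
qed

lemma poset_diagram_pullback:
  assumes "order_preserving P leP Q leQ \<phi>" "poset_diagram Q leQ X leX f"
  shows "poset_diagram P leP (\<lambda>p. X (\<phi> p)) (\<lambda>p. leX (\<phi> p)) (\<lambda>p p'. f (\<phi> p) (\<phi> p'))"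
proof -
  have \<phi>: "\<And>p. p \<in> P \<Longrightarrow> \<phi> p \<in> Q" "\<And>p p'. p \<in> P \<Longrightarrow> p' \<in> P \<Longrightarrow> leP p p' \<Longrightarrow> leQ (\<phi> p) (\<phi> p')"
    using assms(1) by (auto simp: order_preserving_def)
  show ?thesis
    using assms(2) \<phi> unfolding poset_diagram_def by meson
qed

theorem theorem2p12:
  fixes P :: "'p set" and leP :: "'p \<Rightarrow> 'p \<Rightarrow> bool"
    and Q :: "'q set" and leQ :: "'q \<Rightarrow> 'q \<Rightarrow> bool"
    and \<phi> :: "'p \<Rightarrow> 'q"
    and X :: "'q \<Rightarrow> 'x set" and leX :: "'q \<Rightarrow> 'x \<Rightarrow> 'x \<Rightarrow> bool"
    and f :: "'q \<Rightarrow> 'q \<Rightarrow> 'x \<Rightarrow> 'x"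
  assumes "fin_poset P leP" and "fin_poset Q leQ"
    and "order_preserving P leP Q leQ \<phi>"
    and "poset_diagram Q leQ X leX f"
    and "\<forall>q\<in>Q. homotopically_trivial {p\<in>P. \<phi> p \<in> up_set Q leQ q} leP"
  shows "weak_equivalence
           (hocolim_set P (\<lambda>p. X (\<phi> p)))
           (hocolim_le leP (\<lambda>p. leX (\<phi> p)) (\<lambda>p p'. f (\<phi> p) (\<phi> p')))
           (hocolim_set Q X) (hocolim_le leQ leX f)
           (\<lambda>(p, x). (\<phi> p, x))"
proof -
  let ?A = "hocolim_set P (\<lambda>p. X (\<phi> p))"
    and ?leA = "hocolim_le leP (\<lambda>p. leX (\<phi> p)) (\<lambda>p p'. f (\<phi> p) (\<phi> p'))"
    and ?B = "hocolim_set Q X" and ?leB = "hocolim_le leQ leX f"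
    and ?g = "\<lambda>(p, x). (\<phi> p, x :: 'x)"
  have A: "fin_poset ?A ?leA"
    using fin_poset_hocolim[OF assms(1) poset_diagram_pullback[OF assms(3,4)]] .
  have B: "fin_poset ?B ?leB" using fin_poset_hocolim[OF assms(2,4)] .
  have \<phi>: "\<And>p. p \<in> P \<Longrightarrow> \<phi> p \<in> Q" "\<And>p p'. p \<in> P \<Longrightarrow> p' \<in> P \<Longrightarrow> leP p p' \<Longrightarrow> leQ (\<phi> p) (\<phi> p')"
    using assms(3) by (auto simp: order_preserving_def)
  have g: "order_preserving ?A ?leA ?B ?leB ?g"
    using \<phi> by (auto simp: order_preserving_def hocolim_set_def hocolim_le_def)
  have f_in: "f q q' x \<in> X q'" if "q \<in> Q" "q' \<in> Q" "leQ q q'" "x \<in> X q" for q q' x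
    using assms(4) that by (simp add: poset_diagram_def order_preserving_def)
  have f_comp: "f q' q'' (f q q' x) = f q q'' x"
    if "q \<in> Q" "q' \<in> Q" "q'' \<in> Q" "leQ q q'" "leQ q' q''" "x \<in> X q" for q q' q'' x
    using assms(4) that unfolding poset_diagram_def by blast
  have f_id: "f q q x = x" if "q \<in> Q" "x \<in> X q" for q x
    using assms(4) that by (simp add: poset_diagram_def)
  have X_refl: "leX q x x" if "q \<in> Q" "x \<in> X q" for q x
    using assms(4) that by (auto simp: poset_diagram_def fin_poset_def)
  have P_refl: "leP p p" if "p \<in> P" for p
    using assms(1) that by (auto simp: fin_poset_def)
  show ?thesis
  proof (rule quillen_fiber_lemma[OF A B g])
    fix b assume "b \<in> ?B"
    then obtain q x where b: "b = (q, x)" and q: "q \<in> Q" and x: "x \<in> X q"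
      by (auto simp: hocolim_set_def)
    let ?D = "{a\<in>?A. ?g a \<in> up_set ?B ?leB b}" and ?E = "{p\<in>P. \<phi> p \<in> up_set Q leQ q}"
    have D_iff: "(p, y) \<in> ?D \<longleftrightarrow> p \<in> P \<and> y \<in> X (\<phi> p) \<and> leQ q (\<phi> p) \<and> leX (\<phi> p) (f q (\<phi> p) x) y" for p y
      using \<phi> by (auto simp: b hocolim_set_def hocolim_le_def up_set_def)
    have E_iff: "p \<in> ?E \<longleftrightarrow> p \<in> P \<and> leQ q (\<phi> p)" for p
      using \<phi> by (auto simp: up_set_def)
    \<comment> \<open>Over a fixed \<open>p\<close> the upper fibre consists of the elements of
      \<open>X (\<phi> p)\<close> above \<open>f q (\<phi> p) x\<close>; \<open>i\<close> picks the
      least of them.\<close>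
    define i where "i = (\<lambda>p. (p, f q (\<phi> p) x))"
    show "homotopically_trivial ?D ?leA"
    proof (rule homotopically_trivial_retract_below[where E = ?E and leE = leP and i = i and r = fst])
      show "fin_poset ?D ?leA" by (rule fin_poset_subset[OF A]) auto
      show "fin_poset ?E leP" by (rule fin_poset_subset[OF assms(1)]) auto
      show "order_preserving ?E leP ?D ?leA i"
        unfolding order_preserving_def
      proof (intro conjI ballI impI)
        show "i p \<in> ?D" if "p \<in> ?E" for p
          using that \<phi> f_in q x X_refl unfolding i_def D_iff E_iff by blast
        \<comment> \<open>By functoriality the transition map sends \<open>f q (\<phi> p) x\<close>
          to \<open>f q (\<phi> p') x\<close>, so the inequality required in
          \<open>X (\<phi> p')\<close> is reflexivity.\<close>
        show "?leA (i p) (i p')" if "p \<in> ?E" "p' \<in> ?E" "leP p p'" for p p'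
          using that \<phi> f_in[of q "\<phi> p'" x] f_comp[of q "\<phi> p" "\<phi> p'" x] q x X_refl
          unfolding E_iff by (simp add: i_def hocolim_le_def)
      qed
      show "order_preserving ?D ?leA ?E leP fst"
        unfolding order_preserving_def using D_iff E_iff by (auto simp: hocolim_le_def)
      show "fst (i e) = e" for e by (simp add: i_def)
      \<comment> \<open>Both points have the same index, whose transition map is the identity, so
        the claim becomes the inequality defining the fibre.\<close>
      show "?leA (i (fst d)) d" if "d \<in> ?D" for d
      proof -
        obtain p y where d: "d = (p, y)" by (cases d)
        then show ?thesis
          using that D_iff[of p y] \<phi> P_refl f_id f_in[of q "\<phi> p" x] q x by (simp add: i_def hocolim_le_def)
      qed
      show "homotopically_trivial ?E leP" using assms(5) q by blast
    qed
  qed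
qed

end
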